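(* Let $Y,Y_1,Y_2,\dots$ be i.i.d. real random variables such that $a=\inf\{s<0:\mathbb{E}[e^{sY}]<\infty\}<0$ and $b=\sup\{s>0:\mathbb{E}[e^{sY}]<\infty\}>0$. Let $\mu=\mathbb{E}[Y]$, $\sigma^2=\mathbb{E}[|Y-\mu|^2]$, $\nu=\mathbb{E}[(Y-\mu)^3]$, and assume $\sigma>0$. Let $\varphi(s)=\ln\mathbb{E}[e^{s(Y-\mu)}]$ for $s\in(a,b)$, and $X_n=\sum_{i=1}^n(Y_i-\mu)$ for $n\in\mathbb{N}$. Then for every positive integer $m$ and every real $\varepsilon$ with $\lim_{s\downarrow a}\frac{\varphi(s)}{s}<\varepsilon<\lim_{s\uparrow b}\frac{\varphi(s)}{s}$: (i) for all $s\in(a,b)$, \[ \Pr\Big\{\sup_{n\in\mathbb{N}}\big[s(X_n-m\varepsilon)-\varphi(s)(n-m)\big]\ge0\Big\}\le\big[\exp(\varphi(s)-\varepsilon s)\big]^m; \] (ii) the equation $\varphi'(s)=\varepsilon$ has a unique root $\zeta$ in $(a,b)$, and \[ \Pr\Big\{\sup_{n\in\mathbb{N}}\big[\zeta(X_n-m\varepsilon)-\varphi(\zeta)(n-m)\big]\ge0\Big\}\le\big[\exp(\varphi(\zeta)-\varepsilon\zeta)\big]^m; \] (iii) as $\varepsilon\to0$ (with $m$ fixed), \[ \big[\exp(\varphi(\zeta)-\varepsilon\zeta)\big]^m=[1+O(\varepsilon^4)]\Big[\exp\Big(-\frac{\varepsilon^2}{2\sigma^2}+\frac{\nu\varepsilon^3}{6\sigma^6}\Big)\Big]^m=[1+O(\varepsilon^3)]\Big[\exp\Big(-\frac{\varepsilon^2}{2\sigma^2}\Big)\Big]^m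 \] and \[ \frac{\varphi(\zeta)}{\zeta}=\frac{\varepsilon}{2}\Big[1-\frac{\nu\varepsilon}{6\sigma^4}+O(\varepsilon^2)\Big]=\frac{\varepsilon}{2}[1+O(\varepsilon)]. \]
   Context: $\mathbb{N}$ denotes the set of positive integers. $f(x)=O(g(x))$ as $x\to a$ means $\limsup_{x\to a}|f(x)/g(x)|<\infty$; an expression $1+O(\varepsilon^j)$ denotes $1+h(\varepsilon)$ with $h(\varepsilon)=O(\varepsilon^j)$. Here $\zeta=\zeta(\varepsilon)$ depends on $\varepsilon$, and the ratio $\varphi(\zeta)/\zeta$ is considered for $\varepsilon\neq0$. *)

theory Defs
  imports "HOL-Probability.Probability" "HOL-Library.Landau_Symbols"
begin

definition from_above :: "ereal \<Rightarrow> real filter" where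
  "from_above a = (if a = -\<infinity> then at_bot else at_right (real_of_ereal a))"

definition from_below :: "ereal \<Rightarrow> real filter" where
  "from_below b = (if b = \<infinity> then at_top else at_left (real_of_ereal b))"

end

theory Submission
  imports Defs
begin

text \<open>The process \<open>exp (s X\<^sub>n - n \<phi>(s))\<close> is a product of independent nonnegative variables of mean 1, so
  Ville's maximal inequality gives the exponential bound for every \<open>s\<close> in the convergence interval.
  There the moment generating function can be differentiated under the expectation, and \<open>\<phi>''\<close> is a
  variance of an exponentially tilted law, so \<open>\<phi>'\<close> is strictly increasing; by the mean value theorem its
  range contains every value between the limits of \<open>\<phi>(s)/s\<close>. Writing \<open>\<epsilon> = \<phi>'(\<zeta>)\<close> and \<open>\<phi>(\<zeta>)\<close> as Taylor
  polynomials in \<open>\<zeta>\<close> with remainders \<open>O(\<zeta>\<^sup>3)\<close> and \<open>O(\<zeta>\<^sup>4)\<close>, the lower powers of \<open>\<zeta>\<close> cancel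
  in the asserted expansions, and \<open>\<zeta> = O(\<epsilon>)\<close>.\<close>

section \<open>Stopped products and Ville's maximal inequality\<close>

text \<open>From the first index at which \<open>c\<close> times the product reaches 1, every
  further factor is replaced by 1, so the value is frozen there. Writing the level as a multiplier
  \<open>c\<close> avoids division in \<open>ennreal\<close>.\<close>

primrec stopped_prod :: "ennreal \<Rightarrow> (nat \<Rightarrow> ennreal) \<Rightarrow> nat \<Rightarrow> ennreal" where
  "stopped_prod c z 0 = 1"
| "stopped_prod c z (Suc n) =
     stopped_prod c z n * (if 1 \<le> c * stopped_prod c z n then 1 else z (Suc n))"

lemma stopped_prod_cong:
  "(\<And>i. i \<in> {1..n} \<Longrightarrow> z i = z' i) \<Longrightarrow> stopped_prod c z n = stopped_prod c z' n"
  by (induction n) auto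

lemma stopped_prod_reached_mono:
  "1 \<le> c * stopped_prod c z k \<Longrightarrow> k \<le> n \<Longrightarrow> 1 \<le> c * stopped_prod c z n"
  by (rotate_tac 1, induction rule: dec_induct) auto

lemma stopped_prod_eq_or_reached:
  "stopped_prod c z n = (\<Prod>i=1..n. z i) \<or> 1 \<le> c * stopped_prod c z n"
  by (induction n) (auto simp: prod.nat_ivl_Suc' mult.commute)

text \<open>No factor is replaced before the level is reached, so the plain product cannot be above
  it at \<open>k\<close> unless the stopped one has reached it by then; once there, it
  stays.\<close>

lemma stopped_prod_reached:
  assumes "1 \<le> c * (\<Prod>i=1..k. z i)" "k \<le> n"
  shows "1 \<le> c * stopped_prod c z n"
  using stopped_prod_eq_or_reached[of c z k] assms stopped_prod_reached_mono[of c z k n] by auto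

lemma measurable_stopped_prod:
  "{1..n} \<subseteq> J \<Longrightarrow> (\<lambda>z. stopped_prod c z n) \<in> borel_measurable (PiM J (\<lambda>_. borel))"
proof (induction n)
  case (Suc n)
  have [measurable]: "(\<lambda>z. stopped_prod c z n) \<in> borel_measurable (PiM J (\<lambda>_. borel))"
    by (rule Suc.IH) (use Suc.prems in auto)
  have [measurable]: "(\<lambda>z. z (Suc n)) \<in> borel_measurable (PiM J (\<lambda>_. borel))"
    using Suc.prems by (intro measurable_component_singleton) auto
  show ?case by simp
qed simp

context prob_space
begin

lemma indep_var_nn_integral_mult:
  fixes U V :: "'a \<Rightarrow> ennreal"
  assumes "indep_var borel U borel V"
  shows "(\<integral>\<^sup>+x. U x * V x \<partial>M) = (\<integral>\<^sup>+x. U x \<partial>M) * (\<integral>\<^sup>+x. V x \<partial>M)"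
proof -
  have "case_bool borel borel = (\<lambda>_. borel :: ennreal measure)"
    by (auto split: bool.split)
  then have "indep_vars (\<lambda>_. borel) (case_bool U V) UNIV"
    using assms by (simp add: indep_var_def)
  from indep_vars_nn_integral[OF _ this] show ?thesis
    by (simp add: UNIV_bool mult.commute)
qed

context
  fixes Z :: "nat \<Rightarrow> 'a \<Rightarrow> ennreal"
  assumes indep: "indep_vars (\<lambda>_. borel) Z {1..}"
begin

text \<open>The stopped product at \<open>n\<close> is a measurable function of \<open>Z 1\<close>,
  ..., \<open>Z n\<close> alone, and the index sets \<open>{1..n}\<close> and \<open>{Suc n}\<close>
  are disjoint.\<close>

lemma indep_var_stopped_prod:
  "indep_var borel (\<lambda>x. stopped_prod c (\<lambda>i. Z i x) n) borel (Z (Suc n))"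
proof -
  have "indep_var borel ((\<lambda>z. stopped_prod c z n) \<circ> (\<lambda>x. \<lambda>i\<in>{1..n}. Z i x))
      borel ((\<lambda>z. z (Suc n)) \<circ> (\<lambda>x. \<lambda>i\<in>{Suc n}. Z i x))"
    by (intro indep_var_compose[OF indep_var_restrict[OF indep]] measurable_stopped_prod
        measurable_component_singleton) auto
  also have "(\<lambda>z. stopped_prod c z n) \<circ> (\<lambda>x. \<lambda>i\<in>{1..n}. Z i x)
      = (\<lambda>x. stopped_prod c (\<lambda>i. Z i x) n)"
    by (auto simp: fun_eq_iff intro!: stopped_prod_cong)
  also have "(\<lambda>z. z (Suc n)) \<circ> (\<lambda>x. \<lambda>i\<in>{Suc n}. Z i x) = Z (Suc n)"
    by auto
  finally show ?thesis .
qed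

lemma borel_measurable_stopped_prod [measurable]:
  "(\<lambda>x. stopped_prod c (\<lambda>i. Z i x) n) \<in> borel_measurable M"
  using indep_var_rv1[OF indep_var_stopped_prod] .

text \<open>Whether the next factor is used is decided by the first \<open>n\<close> factors, of
  which it is independent; a factor of mean 1 then leaves the integral unchanged.\<close>

lemma nn_integral_stopped_prod:
  assumes mean: "\<And>i. i \<ge> 1 \<Longrightarrow> (\<integral>\<^sup>+x. Z i x \<partial>M) = 1"
  shows "(\<integral>\<^sup>+x. stopped_prod c (\<lambda>i. Z i x) n \<partial>M) = 1"
proof (induction n)
  case (Suc n)
  let ?S = "\<lambda>x. stopped_prod c (\<lambda>i. Z i x) n"
  have [measurable]: "Z (Suc n) \<in> borel_measurable M"
    using indep by (auto simp: indep_vars_def)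
  \<comment> \<open>The part of \<open>?S\<close> that is still below the level is a function of
    \<open>?S\<close>, hence also independent of \<open>Z (Suc n)\<close>.\<close>
  have *: "indep_var borel (\<lambda>x. ?S x * indicator {s. c * s < 1} (?S x)) borel (Z (Suc n))"
  proof -
    have "(\<lambda>s::ennreal. s * indicator {s. c * s < 1} s) \<in> borel_measurable borel" by measurable
    from indep_var_compose[OF indep_var_stopped_prod this measurable_ident] show ?thesis
      by (simp only: comp_def id_apply)
  qed
  have "(\<integral>\<^sup>+x. stopped_prod c (\<lambda>i. Z i x) (Suc n) \<partial>M)
      = (\<integral>\<^sup>+x. ?S x * indicator {s. 1 \<le> c * s} (?S x)
          + ?S x * indicator {s. c * s < 1} (?S x) * Z (Suc n) x \<partial>M)"
    by (intro nn_integral_cong) (auto simp: not_le split: split_indicator)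
  also have "\<dots> = (\<integral>\<^sup>+x. ?S x * indicator {s. 1 \<le> c * s} (?S x) \<partial>M)
          + (\<integral>\<^sup>+x. ?S x * indicator {s. c * s < 1} (?S x) \<partial>M)"
    using mean[of "Suc n"] by (simp add: nn_integral_add indep_var_nn_integral_mult[OF *])
  also have "\<dots> = (\<integral>\<^sup>+x. ?S x * indicator {s. 1 \<le> c * s} (?S x)
          + ?S x * indicator {s. c * s < 1} (?S x) \<partial>M)"
    by (simp add: nn_integral_add)
  also have "\<dots> = (\<integral>\<^sup>+x. ?S x \<partial>M)"
    by (intro nn_integral_cong) (auto simp: not_le split: split_indicator)
  finally show ?case using Suc by simp
qed (simp add: emeasure_space_1)

text \<open>Markov's inequality is applied to the product stopped when it first reaches \<open>1 / c\<close>.\<close>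

lemma Ville_inequality:
  assumes mean: "\<And>i. i \<ge> 1 \<Longrightarrow> (\<integral>\<^sup>+x. Z i x \<partial>M) = 1"
  shows "emeasure M {x \<in> space M. \<exists>n. 1 \<le> c * (\<Prod>i=1..n. Z i x)} \<le> c"
proof -
  let ?A = "\<lambda>n. {x \<in> space M. 1 \<le> c * stopped_prod c (\<lambda>i. Z i x) n}"
  have "emeasure M {x \<in> space M. \<exists>n. 1 \<le> c * (\<Prod>i=1..n. Z i x)} \<le> emeasure M (\<Union>n. ?A n)"
    by (rule emeasure_mono) (use stopped_prod_reached in fastforce)+
  also have "\<dots> = (SUP n. emeasure M (?A n))"
    by (rule SUP_emeasure_incseq[symmetric])
       (auto simp: incseq_def intro: stopped_prod_reached_mono)
  also have "\<dots> \<le> c"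
  proof (rule SUP_least)
    fix n
    have "emeasure M (?A n) \<le> c * (\<integral>\<^sup>+x. stopped_prod c (\<lambda>i. Z i x) n * indicator (space M) x \<partial>M)"
      using nn_integral_Markov_inequality[where u = "\<lambda>x. stopped_prod c (\<lambda>i. Z i x) n" and A = "space M" and c = c and M = M]
      by auto
    also have "\<dots> = c * (\<integral>\<^sup>+x. stopped_prod c (\<lambda>i. Z i x) n \<partial>M)"
      by (intro arg_cong2[of _ _ _ _ "(*)"] nn_integral_cong) auto
    finally show "emeasure M (?A n) \<le> c"
      using nn_integral_stopped_prod[OF mean] by simp
  qed
  finally show ?thesis .
qed

end

end

section \<open>Elementary estimates for the exponential function\<close>

lemma exp_Taylor_remainder:
  fixes x :: real
  shows "\<bar>exp x - (\<Sum>k<n. x ^ k / fact k)\<bar> \<le> \<bar>x\<bar> ^ n / fact n * exp \<bar>x\<bar>"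
proof -
  obtain t where t: "\<bar>t\<bar> \<le> \<bar>x\<bar>" "exp x = (\<Sum>k<n. x ^ k / fact k) + exp t / fact n * x ^ n"
    using Maclaurin_exp_le[of x n] by blast
  have "exp t \<le> exp \<bar>x\<bar>" using t(1) by auto
  then show ?thesis
    using mult_left_mono[of "exp t" "exp \<bar>x\<bar>" "\<bar>x\<bar> ^ n / fact n"]
    by (simp add: t(2) abs_mult power_abs field_simps)
qed

text \<open>A single term of the exponential series is at most the whole sum when the argument is
  nonnegative. This later absorbs powers into a slightly larger exponential.\<close>

lemma power_le_exp:
  fixes x :: real
  assumes "0 \<le> x"
  shows "x ^ k \<le> fact k * exp x"
proof -
  obtain t where t: "exp x = (\<Sum>i<Suc k. x ^ i / fact i) + exp t / fact (Suc k) * x ^ Suc k"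
    using Maclaurin_exp_le[of x "Suc k"] by blast
  have "0 \<le> (\<Sum>i<k. x ^ i / fact i)" "0 \<le> exp t / fact (Suc k) * x ^ Suc k"
    using assms by (auto intro!: sum_nonneg simp del: power_Suc fact_Suc)
  then have "x ^ k / fact k \<le> exp x" unfolding t by simp
  then show ?thesis by (simp add: field_simps)
qed

section \<open>Exponentially weighted moments and their Taylor expansions\<close>

text \<open>\<open>W\<close> stands for one centred summand and \<open>I\<close> for the convergence
  interval. The analysis of the generating function concerns a single law, so it is kept apart from
  the i.i.d. sequence.\<close>

locale centered_mgf = prob_space M for M :: "'a measure" +
  fixes W :: "'a \<Rightarrow> real" and I :: "real set"
  assumes W [measurable]: "W \<in> borel_measurable M"
    and open_I: "open I" and interval_I: "is_interval I" and zero_I: "0 \<in> I"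
    and integrable_exp: "s \<in> I \<Longrightarrow> integrable M (\<lambda>x. exp (s * W x))"
    and mean_zero: "expectation W = 0"
    and variance_pos: "expectation (\<lambda>x. W x ^ 2) > 0"
begin

text \<open>This is the k-th derivative of the moment generating function, written as an
  expectation; divided by \<open>tilt 0 s\<close> it is the k-th moment of the exponentially tilted
  law.\<close>

definition tilt :: "nat \<Rightarrow> real \<Rightarrow> real" where
  "tilt k s = expectation (\<lambda>x. W x ^ k * exp (s * W x))"

text \<open>The extra factor with \<delta> leaves room for moving \<open>s\<close> by up to
  \<delta>, so that one integrable function dominates the Taylor remainders for all small
  shifts.\<close>

lemma integrable_power_exp_margin:
  assumes "s \<in> I"
  obtains \<delta> where "\<delta> > 0" "\<And>k. integrable M (\<lambda>x. \<bar>W x\<bar> ^ k * exp (s * W x + \<delta> * \<bar>W x\<bar>))"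
proof -
  obtain e where e: "e > 0" "cball s e \<subseteq> I"
    using open_I assms open_contains_cball by blast
  \<comment> \<open>One half of \<open>e\<close> absorbs the power of |w|, the other half is the
    margin. Together they give the exponent s * w + e * |w|, which is covered by the exponentials at
    \<open>s + e\<close> and \<open>s - e\<close>.\<close>
  define \<delta> where "\<delta> = e / 2"
  have \<delta>: "\<delta> > 0" using e by (simp add: \<delta>_def)
  have "s + e \<in> cball s e" "s - e \<in> cball s e" using e by (auto simp: dist_real_def)
  then have int: "integrable M (\<lambda>x. exp ((s + e) * W x))" "integrable M (\<lambda>x. exp ((s - e) * W x))"
    using e integrable_exp by (auto simp: subset_eq)
  show ?thesis
  proof (rule that[OF \<delta>])
    fix k
    define C where "C = fact k / \<delta> ^ k"
    have C: "C \<ge> 0" using \<delta> by (simp add: C_def)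
    have "\<bar>w\<bar> ^ k * exp (s * w + \<delta> * \<bar>w\<bar>) \<le> C * (exp ((s + e) * w) + exp ((s - e) * w))" for w :: real
    proof -
      have "(\<delta> * \<bar>w\<bar>) ^ k \<le> fact k * exp (\<delta> * \<bar>w\<bar>)" using \<delta> by (intro power_le_exp) simp
      then have "\<bar>w\<bar> ^ k \<le> C * exp (\<delta> * \<bar>w\<bar>)"
        using \<delta> by (simp add: C_def field_simps power_mult_distrib)
      then have "\<bar>w\<bar> ^ k * exp (s * w + \<delta> * \<bar>w\<bar>)
          \<le> C * exp (\<delta> * \<bar>w\<bar>) * exp (s * w + \<delta> * \<bar>w\<bar>)"
        by (intro mult_right_mono) auto
      also have "\<dots> = C * exp (s * w + e * \<bar>w\<bar>)"
        unfolding mult.assoc exp_add[symmetric] by (simp add: \<delta>_def algebra_simps)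
      also have "\<dots> \<le> C * (exp ((s + e) * w) + exp ((s - e) * w))"
      proof (rule mult_left_mono)
        show "exp (s * w + e * \<bar>w\<bar>) \<le> exp ((s + e) * w) + exp ((s - e) * w)"
          by (cases "w \<ge> 0") (auto simp: algebra_simps)
      qed (rule C)
      finally show ?thesis .
    qed
    then have bound: "norm (\<bar>W x\<bar> ^ k * exp (s * W x + \<delta> * \<bar>W x\<bar>))
        \<le> norm (C * (exp ((s + e) * W x) + exp ((s - e) * W x)))" for x
      using C by (simp add: abs_mult)
    show "integrable M (\<lambda>x. \<bar>W x\<bar> ^ k * exp (s * W x + \<delta> * \<bar>W x\<bar>))"
      by (rule Bochner_Integration.integrable_bound[OF _ _ AE_I2[OF bound]])
         (intro integrable_mult_right Bochner_Integration.integrable_add int, simp)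
  qed
qed

lemma integrable_power_exp:
  assumes "s \<in> I"
  shows "integrable M (\<lambda>x. W x ^ k * exp (s * W x))"
proof -
  obtain \<delta> where \<delta>: "\<delta> > 0" "\<And>k. integrable M (\<lambda>x. \<bar>W x\<bar> ^ k * exp (s * W x + \<delta> * \<bar>W x\<bar>))"
    using integrable_power_exp_margin[OF assms] by blast
  from \<delta>(2)[of k] show ?thesis
    using \<delta>(1) by (elim Bochner_Integration.integrable_bound)
       (simp_all add: abs_mult power_abs mult_left_mono)
qed

text \<open>The Taylor polynomial of exp (h * w) is taken inside the expectation and the pointwise
  remainder is integrated. Differentiability of \<open>tilt\<close> is a consequence, derived
  afterwards.\<close>

lemma tilt_Taylor:
  assumes "s \<in> I"
  obtains C \<delta> where "\<delta> > 0"
    "\<And>h. \<bar>h\<bar> \<le> \<delta> \<Longrightarrow> s + h \<in> I \<Longrightarrow>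
      \<bar>tilt j (s + h) - (\<Sum>k<n. h ^ k / fact k * tilt (j + k) s)\<bar> \<le> C * \<bar>h\<bar> ^ n"
proof -
  obtain \<delta> where \<delta>: "\<delta> > 0" "\<And>k. integrable M (\<lambda>x. \<bar>W x\<bar> ^ k * exp (s * W x + \<delta> * \<bar>W x\<bar>))"
    using integrable_power_exp_margin[OF assms] by blast
  define D where "D = expectation (\<lambda>x. \<bar>W x\<bar> ^ (j + n) * exp (s * W x + \<delta> * \<bar>W x\<bar>))"
  show ?thesis
  proof (rule that[OF \<delta>(1)])
    fix h assume h: "\<bar>h\<bar> \<le> \<delta>" "s + h \<in> I"
    let ?R = "\<lambda>w::real. w ^ j * exp ((s + h) * w) - (\<Sum>k<n. h ^ k / fact k * (w ^ (j + k) * exp (s * w)))"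
    have R: "\<bar>?R w\<bar> \<le> \<bar>h\<bar> ^ n / fact n * (\<bar>w\<bar> ^ (j + n) * exp (s * w + \<delta> * \<bar>w\<bar>))" for w
    proof -
      have "?R w = w ^ j * exp (s * w) * (exp (h * w) - (\<Sum>k<n. (h * w) ^ k / fact k))"
        by (simp add: algebra_simps exp_add sum_distrib_left power_add power_mult_distrib)
      then have "\<bar>?R w\<bar> = \<bar>w\<bar> ^ j * exp (s * w) * \<bar>exp (h * w) - (\<Sum>k<n. (h * w) ^ k / fact k)\<bar>"
        by (simp add: abs_mult power_abs)
      also have "\<dots> \<le> \<bar>w\<bar> ^ j * exp (s * w) * (\<bar>h * w\<bar> ^ n / fact n * exp \<bar>h * w\<bar>)"
        by (intro mult_left_mono exp_Taylor_remainder) auto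
      also have "\<dots> \<le> \<bar>w\<bar> ^ j * exp (s * w) * (\<bar>h * w\<bar> ^ n / fact n * exp (\<delta> * \<bar>w\<bar>))"
        using h by (intro mult_left_mono) (auto simp: abs_mult intro!: mult_right_mono)
      also have "\<dots> = \<bar>h\<bar> ^ n / fact n * (\<bar>w\<bar> ^ (j + n) * exp (s * w + \<delta> * \<bar>w\<bar>))"
        by (simp add: exp_add power_add abs_mult power_mult_distrib)
      finally show ?thesis .
    qed
    have intR: "integrable M (\<lambda>x. ?R (W x))"
      by (intro Bochner_Integration.integrable_diff Bochner_Integration.integrable_sum integrable_mult_right
          integrable_power_exp h assms)
    have eq: "tilt j (s + h) - (\<Sum>k<n. h ^ k / fact k * tilt (j + k) s) = expectation (\<lambda>x. ?R (W x))"
      using h assms by (simp add: tilt_def integrable_power_exp del: times_divide_eq_left)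
    have "\<bar>expectation (\<lambda>x. ?R (W x))\<bar>
        \<le> expectation (\<lambda>x. \<bar>h\<bar> ^ n / fact n * (\<bar>W x\<bar> ^ (j + n) * exp (s * W x + \<delta> * \<bar>W x\<bar>)))"
      by (rule order_trans[OF integral_abs_bound], rule integral_mono)
         (intro integrable_abs intR integrable_mult_right \<delta> R)+
    then show "\<bar>tilt j (s + h) - (\<Sum>k<n. h ^ k / fact k * tilt (j + k) s)\<bar> \<le> D / fact n * \<bar>h\<bar> ^ n"
      unfolding eq D_def integral_mult_right_zero by (simp add: mult_ac)
  qed
qed

lemma eventually_shift_in_I: "s \<in> I \<Longrightarrow> eventually (\<lambda>h. s + h \<in> I) (nhds 0)"
proof -
  assume "s \<in> I"
  then have "eventually (\<lambda>u. u \<in> I) (nhds (s + 0))"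
    using open_I by (auto simp: eventually_nhds)
  moreover have "filterlim (\<lambda>h. s + h) (nhds (s + 0)) (nhds 0)"
    by (intro tendsto_add tendsto_const filterlim_ident)
  ultimately show ?thesis by (rule eventually_compose_filterlim)
qed

text \<open>The filter is \<open>nhds 0\<close> rather than \<open>at 0\<close>, so that any
  function tending to 0 can be substituted for \<open>h\<close>.\<close>

lemma tilt_Taylor_bigo:
  assumes "s \<in> I"
  shows "(\<lambda>h. tilt j (s + h) - (\<Sum>k<n. h ^ k / fact k * tilt (j + k) s)) \<in> O[nhds 0](\<lambda>h. h ^ n)"
proof -
  obtain C \<delta> where *: "\<delta> > 0" "\<And>h. \<bar>h\<bar> \<le> \<delta> \<Longrightarrow> s + h \<in> I \<Longrightarrow>
      \<bar>tilt j (s + h) - (\<Sum>k<n. h ^ k / fact k * tilt (j + k) s)\<bar> \<le> C * \<bar>h\<bar> ^ n"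
    using tilt_Taylor[OF assms] by blast
  have "eventually (\<lambda>h. \<bar>h\<bar> \<le> \<delta>) (nhds 0)"
    unfolding eventually_nhds_metric using *(1) by (intro exI[of _ \<delta>]) auto
  with eventually_shift_in_I[OF assms]
  have "eventually (\<lambda>h. norm (tilt j (s + h) - (\<Sum>k<n. h ^ k / fact k * tilt (j + k) s)) \<le> C * norm (h ^ n)) (nhds 0)"
    by eventually_elim (use *(2) in \<open>simp only: real_norm_def power_abs\<close>)
  then show ?thesis by (rule bigoI)
qed

text \<open>With two Taylor terms the error is O(h^2), so the difference quotient differs from
  \<open>tilt (Suc j) s\<close> by O(h).\<close>

lemma DERIV_tilt:
  assumes "s \<in> I"
  shows "(tilt j has_real_derivative tilt (Suc j) s) (at s)"
proof -
  have "(\<lambda>h. tilt j (s + h) - (tilt j s + h * tilt (Suc j) s)) \<in> O[at 0](\<lambda>h. h ^ 2)"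
  proof (rule landau_o.big.filter_mono)
    show "at 0 \<le> nhds (0::real)" by (simp add: at_within_def)
    show "(\<lambda>h. tilt j (s + h) - (tilt j s + h * tilt (Suc j) s)) \<in> O[nhds 0](\<lambda>h. h ^ 2)"
      using tilt_Taylor_bigo[OF assms, of j 2] by (simp add: lessThan_nat_numeral add.commute)
  qed
  then have "(\<lambda>h. (tilt j (s + h) - (tilt j s + h * tilt (Suc j) s)) / h) \<in> O[at 0](\<lambda>h. h ^ 2 / h)"
    by (intro landau_o.big.divide_right) (auto simp: eventually_at_filter)
  also have "(\<lambda>h::real. h ^ 2 / h) = (\<lambda>h. h)" by (auto simp: power2_eq_square)
  also have "(\<lambda>h::real. h) \<in> o[at 0](\<lambda>_. 1)"
    by (intro smalloI_tendsto) (auto intro!: tendsto_eq_intros)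
  finally have "(\<lambda>h. (tilt j (s + h) - (tilt j s + h * tilt (Suc j) s)) / h) \<midarrow>0\<rightarrow> 0"
    by (auto dest: smalloD_tendsto)
  then have "(\<lambda>h. (tilt j (s + h) - (tilt j s + h * tilt (Suc j) s)) / h + tilt (Suc j) s) \<midarrow>0\<rightarrow> 0 + tilt (Suc j) s"
    by (intro tendsto_intros)
  then show ?thesis
    unfolding DERIV_def
    by (simp, elim Lim_transform_eventually) (auto simp: eventually_at_filter field_simps)
qed

lemma tilt_0_pos: "s \<in> I \<Longrightarrow> tilt 0 s > 0"
  unfolding tilt_def using integral_less_AE_space[of "\<lambda>_. 0" "\<lambda>x. exp (s * W x)"] integrable_exp
  by (simp add: emeasure_space_1)

lemma tilt_at_0:
  "tilt 0 0 = 1" "tilt (Suc 0) 0 = 0" "tilt k 0 = expectation (\<lambda>x. W x ^ k)"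
  using mean_zero by (auto simp: tilt_def prob_space)

section \<open>The cumulant generating function and strict monotonicity of its derivative\<close>

definition cgf where "cgf s = ln (tilt 0 s)"

definition cgf' where "cgf' s = tilt 1 s / tilt 0 s"

lemma cgf_0: "cgf 0 = 0" "cgf' 0 = 0"
  using tilt_at_0(1,2) by (simp_all add: cgf_def cgf'_def)

lemma DERIV_cgf: "s \<in> I \<Longrightarrow> (cgf has_real_derivative cgf' s) (at s)"
  unfolding cgf_def[abs_def] cgf'_def
  using DERIV_chain2[OF DERIV_ln DERIV_tilt[of s 0]] tilt_0_pos[of s] by (simp add: divide_inverse mult.commute)

text \<open>The numerator of the second derivative of \<open>cgf\<close> is a variance under the exponentially tilted
  measure.\<close>

lemma tilted_variance_pos:
  assumes s: "s \<in> I"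
  shows "tilt 2 s * tilt 0 s - tilt 1 s * tilt 1 s > 0"
proof -
  \<comment> \<open>The mean of the tilted law; the expectation of \<open>?V\<close> is then the
    tilted variance times \<open>tilt 0 s\<close>.\<close>
  define c where "c = tilt 1 s / tilt 0 s"
  note int = integrable_power_exp[OF s, of 0] integrable_power_exp[OF s, of 1] integrable_power_exp[OF s, of 2]
  let ?V = "\<lambda>x. (W x - c)\<^sup>2 * exp (s * W x)"
  have V: "?V = (\<lambda>x. W x ^ 2 * exp (s * W x) - 2 * c * (W x ^ 1 * exp (s * W x)) + c\<^sup>2 * (W x ^ 0 * exp (s * W x)))"
    by (auto simp: power2_eq_square algebra_simps)
  have intV: "integrable M ?V" unfolding V using int by (intro Bochner_Integration.integrable_add Bochner_Integration.integrable_diff integrable_mult_right) auto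
  have "expectation ?V = tilt 2 s - 2 * c * tilt 1 s + c\<^sup>2 * tilt 0 s"
    unfolding V tilt_def using int by simp
  also have "\<dots> = (tilt 2 s * tilt 0 s - tilt 1 s * tilt 1 s) / tilt 0 s"
    using tilt_0_pos[OF s] by (simp add: c_def power2_eq_square field_simps)
  finally have eq: "expectation ?V = (tilt 2 s * tilt 0 s - tilt 1 s * tilt 1 s) / tilt 0 s" .
  \<comment> \<open>A vanishing integral would make \<open>W\<close> almost surely equal to
    \<open>c\<close>; mean 0 then gives c = 0, against the positive second moment.\<close>
  have "expectation ?V \<noteq> 0"
  proof
    assume "expectation ?V = 0"
    then have "AE x in M. W x = c"
      using integral_nonneg_eq_0_iff_AE[OF intV] by auto
    then have "expectation W = expectation (\<lambda>_. c)" "expectation (\<lambda>x. W x ^ 2) = expectation (\<lambda>_. c ^ 2)"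
      by (auto intro!: integral_cong_AE simp del: lebesgue_integral_const)
    then show False using mean_zero variance_pos by (simp add: prob_space)
  qed
  moreover have "expectation ?V \<ge> 0" by (intro integral_nonneg_AE) auto
  ultimately have "expectation ?V > 0" by linarith
  then show ?thesis using tilt_0_pos[OF s] unfolding eq by (simp add: zero_less_divide_iff)
qed

lemma between_in_I: "s \<in> I \<Longrightarrow> u \<in> I \<Longrightarrow> s \<le> t \<Longrightarrow> t \<le> u \<Longrightarrow> t \<in> I"
  using interval_I unfolding is_interval_1 by blast

lemma DERIV_cgf':
  assumes "s \<in> I"
  shows "(cgf' has_real_derivative (tilt 2 s * tilt 0 s - tilt 1 s * tilt 1 s) / (tilt 0 s * tilt 0 s)) (at s)"
proof -
  have "Suc (Suc 0) = 2" by simp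
  then show ?thesis
    unfolding cgf'_def[abs_def] using tilt_0_pos[OF assms]
    using DERIV_divide[OF DERIV_tilt[OF assms, of 1] DERIV_tilt[OF assms, of 0]] by (simp add: numeral_2_eq_2)
qed

lemma cgf'_strict_mono:
  assumes "s \<in> I" "u \<in> I" "s < u"
  shows "cgf' s < cgf' u"
proof (rule DERIV_pos_imp_increasing[OF assms(3)])
  fix x assume "s \<le> x" "x \<le> u"
  then have "x \<in> I" using between_in_I assms by blast
  then show "\<exists>y. (cgf' has_real_derivative y) (at x) \<and> 0 < y"
    using DERIV_cgf' tilted_variance_pos tilt_0_pos by (intro exI conjI) (auto simp: zero_less_mult_iff)
qed

lemma cgf_MVT:
  assumes "s \<in> I" "u \<in> I" "s < u"
  obtains t where "s < t" "t < u" "t \<in> I" "cgf u - cgf s = (u - s) * cgf' t"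
proof -
  obtain t where "s < t" "t < u" "cgf u - cgf s = (u - s) * cgf' t"
    using MVT2[OF assms(3), of cgf cgf'] DERIV_cgf between_in_I assms by blast
  then show ?thesis using that[of t] between_in_I[of s u t] assms by auto
qed

end

section \<open>Asymptotic inversion and exponentials of small remainders\<close>

text \<open>Both claims are polynomial identities in \<open>z\<close> up to remainders: after
  \<epsilon> and \<open>p\<close> are replaced by their expansions the low powers of
  \<open>z\<close> cancel, and z = O(\<epsilon>) turns the surviving power into one of \<epsilon>.
  In the application \<open>v\<close> and \<open>n\<close> are the second and third central
  moments.\<close>

lemma asymptotic_inversion:
  fixes z p :: "real \<Rightarrow> real" and v n :: real
  assumes v: "v > 0" and z0: "(z \<longlongrightarrow> 0) (at 0)" and znz: "eventually (\<lambda>\<epsilon>. z \<epsilon> \<noteq> 0) (at 0)"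
    and E: "(\<lambda>\<epsilon>. \<epsilon> - (v * z \<epsilon> + n * z \<epsilon> ^ 2 / 2)) \<in> O[at 0](\<lambda>\<epsilon>. z \<epsilon> ^ 3)"
    and P: "(\<lambda>\<epsilon>. p \<epsilon> - (v * z \<epsilon> ^ 2 / 2 + n * z \<epsilon> ^ 3 / 6)) \<in> O[at 0](\<lambda>\<epsilon>. z \<epsilon> ^ 4)"
  shows "(\<lambda>\<epsilon>. p \<epsilon> - \<epsilon> * z \<epsilon> - (- (\<epsilon>^2) / (2 * v) + n * \<epsilon>^3 / (6 * v^3))) \<in> O[at 0](\<lambda>\<epsilon>. \<epsilon> ^ 4)"
    and "(\<lambda>\<epsilon>. p \<epsilon> / z \<epsilon> / (\<epsilon> / 2) - (1 - n * \<epsilon> / (6 * v^2))) \<in> O[at 0](\<lambda>\<epsilon>. \<epsilon> ^ 2)"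
proof -
  \<comment> \<open>The remainders are divided by their order, which turns the O-statements into
    exact equations with bounded coefficients \<rho>, \<kappa> and \<open>w\<close>. The
    cancellations are then plain field arithmetic.\<close>
  define \<rho> where "\<rho> \<epsilon> = (\<epsilon> - (v * z \<epsilon> + n * z \<epsilon> ^ 2 / 2)) / z \<epsilon> ^ 3" for \<epsilon>
  define \<kappa> where "\<kappa> \<epsilon> = (p \<epsilon> - (v * z \<epsilon> ^ 2 / 2 + n * z \<epsilon> ^ 3 / 6)) / z \<epsilon> ^ 4" for \<epsilon>
  define w where "w \<epsilon> = n / 2 + z \<epsilon> * \<rho> \<epsilon>" for \<epsilon>
  have znz': "eventually (\<lambda>\<epsilon>. z \<epsilon> ^ k \<noteq> 0) (at 0)" for k
    using znz by eventually_elim simp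
  have \<rho>: "\<rho> \<in> O[at 0](\<lambda>_. 1)"
    unfolding \<rho>_def[abs_def] by (subst landau_o.big.divide_eq2[OF znz']) (use E in simp)
  have \<kappa>: "\<kappa> \<in> O[at 0](\<lambda>_. 1)"
    unfolding \<kappa>_def[abs_def] by (subst landau_o.big.divide_eq2[OF znz']) (use P in simp)
  have z_small: "z \<in> o[at 0](\<lambda>_. 1)"
    using z0 by (intro smalloI_tendsto) auto
  then have z: "z \<in> O[at 0](\<lambda>_. 1)" by (rule landau_o.small_imp_big)
  have w: "w \<in> O[at 0](\<lambda>_. 1)"
    unfolding w_def[abs_def] by (intro sum_in_bigo landau_o.big.mult_in_1 z \<rho>) simp
  have E': "eventually (\<lambda>\<epsilon>. \<epsilon> = v * z \<epsilon> + z \<epsilon> ^ 2 * w \<epsilon>) (at 0)"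
    using znz by eventually_elim (simp add: \<rho>_def w_def field_simps power2_eq_square power3_eq_cube)
  have P': "eventually (\<lambda>\<epsilon>. p \<epsilon> = v * z \<epsilon> ^ 2 / 2 + n * z \<epsilon> ^ 3 / 6 + z \<epsilon> ^ 4 * \<kappa> \<epsilon>) (at 0)"
    using znz by eventually_elim (simp add: \<kappa>_def field_simps)

  \<comment> \<open>Since \<epsilon> - v * z is z times a null function, \<epsilon> and v * z are
    asymptotically equivalent.\<close>
  have z_O: "z \<in> O[at 0](\<lambda>\<epsilon>. \<epsilon>)"
  proof -
    have "(\<lambda>\<epsilon>. z \<epsilon> * (z \<epsilon> * w \<epsilon>)) \<in> o[at 0](\<lambda>\<epsilon>. z \<epsilon> * 1)"
      using landau_o.small_big_mult[OF z_small w] by (intro landau_o.big_small_mult) auto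
    then have "(\<lambda>\<epsilon>. \<epsilon> - v * z \<epsilon>) \<in> o[at 0](\<lambda>\<epsilon>. v * z \<epsilon>)"
      using v by (subst landau_o.small.in_cong[where g = "\<lambda>\<epsilon>. z \<epsilon> * (z \<epsilon> * w \<epsilon>)"])
        (use E' in \<open>eventually_elim, simp add: power2_eq_square\<close>, simp)
    then have "(\<lambda>\<epsilon>. \<epsilon>) \<sim>[at 0] (\<lambda>\<epsilon>. v * z \<epsilon>)"
      by (rule smallo_imp_asymp_equiv)
    then have "(\<lambda>\<epsilon>. v * z \<epsilon>) \<in> O[at 0](\<lambda>\<epsilon>. \<epsilon>)"
      by (rule asymp_equiv_imp_bigo[OF asymp_equiv_symI])
    then show ?thesis using v by simp
  qed

  \<comment> \<open>The left side divided by z^4. The terms in z^2 and z^3, including those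
    containing \<open>w\<close>, cancel.\<close>
  let ?Q = "\<lambda>\<epsilon>. \<kappa> \<epsilon> + w \<epsilon> * w \<epsilon> * (1 / (2 * v)) - (3 * v^2 * w \<epsilon> + 3 * v * (z \<epsilon> * (w \<epsilon> * w \<epsilon>)) + z \<epsilon> * z \<epsilon> * (w \<epsilon> * w \<epsilon> * w \<epsilon>)) * (n / (6 * v^3))"
  have Q: "?Q \<in> O[at 0](\<lambda>_. 1)"
    by (intro sum_in_bigo landau_o.big.mult_in_1 z \<kappa> w) auto
  have "(\<lambda>\<epsilon>. z \<epsilon> ^ 4 * ?Q \<epsilon>) \<in> O[at 0](\<lambda>\<epsilon>. \<epsilon> ^ 4 * 1)"
    by (intro landau_o.big.mult landau_o.big_power z_O Q)
  moreover have "eventually (\<lambda>\<epsilon>. p \<epsilon> - \<epsilon> * z \<epsilon> - (- (\<epsilon>^2) / (2 * v) + n * \<epsilon>^3 / (6 * v^3)) = z \<epsilon> ^ 4 * ?Q \<epsilon>) (at 0)"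
    using E' P'
  proof eventually_elim
    case (elim \<epsilon>)
    define x y k where "x = z \<epsilon>" and "y = w \<epsilon>" and "k = \<kappa> \<epsilon>"
    have e: "\<epsilon> = v * x + x^2 * y" and pe: "p \<epsilon> = v * x ^ 2 / 2 + n * x ^ 3 / 6 + x ^ 4 * k"
      using elim by (simp_all add: x_def y_def k_def)
    show ?case unfolding x_def[symmetric] y_def[symmetric] k_def[symmetric] pe unfolding e using v
      by (simp add: field_simps power2_eq_square power3_eq_cube power4_eq_xxxx)
  qed
  ultimately show "(\<lambda>\<epsilon>. p \<epsilon> - \<epsilon> * z \<epsilon> - (- (\<epsilon>^2) / (2 * v) + n * \<epsilon>^3 / (6 * v^3))) \<in> O[at 0](\<lambda>\<epsilon>. \<epsilon> ^ 4)"
    by (subst landau_o.big.in_cong) auto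

  \<comment> \<open>What remains of 2 * p / z - \<epsilon> + n * \<epsilon>^2 / (6 * v^2) after
    division by z^3. The z^2 coefficients n/3 - w + n/6 combine to -z * \<rho>, which is why
    \<open>w\<close> is split as n/2 + z * \<rho>.\<close>
  let ?R = "\<lambda>\<epsilon>. 2 * \<kappa> \<epsilon> - \<rho> \<epsilon> + (2 * v * w \<epsilon> + z \<epsilon> * (w \<epsilon> * w \<epsilon>)) * (n / (6 * v^2))"
  have R: "?R \<in> O[at 0](\<lambda>_. 1)"
    by (intro sum_in_bigo landau_o.big.mult_in_1 z \<kappa> w \<rho>) auto
  have nz: "eventually (\<lambda>\<epsilon>::real. \<epsilon> \<noteq> 0) (at 0)" by (simp add: eventually_at_filter)
  have "(\<lambda>\<epsilon>. z \<epsilon> ^ 3 * ?R \<epsilon> / \<epsilon>) \<in> O[at 0](\<lambda>\<epsilon>. \<epsilon> ^ 3 * 1 / \<epsilon>)"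
    by (intro landau_o.big.divide_right nz landau_o.big.mult landau_o.big_power z_O R)
  also have "(\<lambda>\<epsilon>::real. \<epsilon> ^ 3 * 1 / \<epsilon>) = (\<lambda>\<epsilon>. \<epsilon> ^ 2)"
    by (auto simp: power2_eq_square power3_eq_cube)
  finally have "(\<lambda>\<epsilon>. z \<epsilon> ^ 3 * ?R \<epsilon> / \<epsilon>) \<in> O[at 0](\<lambda>\<epsilon>. \<epsilon> ^ 2)" .
  moreover have "eventually (\<lambda>\<epsilon>. p \<epsilon> / z \<epsilon> / (\<epsilon> / 2) - (1 - n * \<epsilon> / (6 * v^2)) = z \<epsilon> ^ 3 * ?R \<epsilon> / \<epsilon>) (at 0)"
    using E' P' znz nz
  proof eventually_elim
    case (elim \<epsilon>)
    define x y k r where "x = z \<epsilon>" and "y = w \<epsilon>" and "k = \<kappa> \<epsilon>" and "r = \<rho> \<epsilon>"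
    have e: "\<epsilon> = v * x + x^2 * y" and pe: "p \<epsilon> = v * x ^ 2 / 2 + n * x ^ 3 / 6 + x ^ 4 * k"
      and y: "y = n / 2 + x * r" and x: "x \<noteq> 0"
      using elim by (simp_all add: x_def y_def k_def r_def w_def)
    have "2 * (p \<epsilon> / x) - \<epsilon> + n * \<epsilon> ^ 2 / (6 * v^2) = x ^ 3 * (2 * k - r + (2 * v * y + x * (y * y)) * (n / (6 * v^2)))"
      unfolding pe unfolding e unfolding y using v x
      by (simp add: field_simps power2_eq_square power3_eq_cube power4_eq_xxxx)
    then show ?case unfolding x_def[symmetric] y_def[symmetric] k_def[symmetric] r_def[symmetric]
      using elim(4) by (simp add: field_simps power2_eq_square)
  qed
  ultimately show "(\<lambda>\<epsilon>. p \<epsilon> / z \<epsilon> / (\<epsilon> / 2) - (1 - n * \<epsilon> / (6 * v^2))) \<in> O[at 0](\<lambda>\<epsilon>. \<epsilon> ^ 2)"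
    by (subst landau_o.big.in_cong) auto
qed

lemma exp_minus_1_bigo:
  fixes d g :: "'b \<Rightarrow> real"
  assumes "d \<in> O[F](g)" "(g \<longlongrightarrow> 0) F"
  shows "(\<lambda>x. exp (d x) - 1) \<in> O[F](g)"
proof -
  have "g \<in> o[F](\<lambda>_. 1)" using assms(2) by (intro smalloI_tendsto) auto
  from landau_o.big_small_trans[OF assms(1) this] have "(d \<longlongrightarrow> 0) F"
    by (auto dest: smalloD_tendsto)
  then have "eventually (\<lambda>x. \<bar>d x\<bar> < 1) F"
    using tendstoD[of d 0 F 1] by (simp add: dist_real_def)
  then have "eventually (\<lambda>x. norm (exp (d x) - 1) \<le> exp 1 * norm (d x)) F"
  proof eventually_elim
    case (elim x)
    have "\<bar>exp (d x) - 1\<bar> \<le> \<bar>d x\<bar> * exp \<bar>d x\<bar>" using exp_Taylor_remainder[of "d x" 1] by simp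
    also have "\<dots> \<le> \<bar>d x\<bar> * exp 1" using elim by (intro mult_left_mono) auto
    finally show ?case by (simp add: mult.commute)
  qed
  then have "(\<lambda>x. exp (d x) - 1) \<in> O[F](d)" by (rule bigoI)
  then show ?thesis using assms(1) by (rule landau_o.big_trans)
qed

text \<open>The quotient equals exp (m * (A - B)), so an absolute error in the exponent becomes a
  relative error of the same order. Quotient minus 1 is the encoding of a factor 1 +
  O(\<epsilon>^k).\<close>

lemma exp_power_ratio_bigo:
  fixes A B :: "real \<Rightarrow> real"
  assumes "(\<lambda>\<epsilon>. A \<epsilon> - B \<epsilon>) \<in> O[at 0](\<lambda>\<epsilon>. \<epsilon> ^ k)" "k > 0"
  shows "(\<lambda>\<epsilon>. exp (A \<epsilon>) ^ m / exp (B \<epsilon>) ^ m - 1) \<in> O[at 0](\<lambda>\<epsilon>. \<epsilon> ^ k)"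
proof -
  have "(\<lambda>\<epsilon>. real m * (A \<epsilon> - B \<epsilon>)) \<in> O[at 0](\<lambda>\<epsilon>. \<epsilon> ^ k)"
    using assms(1) by (cases "m = 0") auto
  moreover have "((\<lambda>\<epsilon>::real. \<epsilon> ^ k) \<longlongrightarrow> 0) (at 0)"
    using assms(2) by (auto intro!: tendsto_eq_intros)
  ultimately have "(\<lambda>\<epsilon>. exp (real m * (A \<epsilon> - B \<epsilon>)) - 1) \<in> O[at 0](\<lambda>\<epsilon>. \<epsilon> ^ k)"
    by (rule exp_minus_1_bigo)
  then show ?thesis
    by (simp add: exp_of_nat_mult[symmetric] exp_diff[symmetric] right_diff_distrib)
qed

section \<open>Chord slopes, the root of the derivative equation, and expansions at the
  origin\<close>

context centered_mgf
begin

text \<open>By the mean value theorem \<open>cgf s / s\<close> is a value of \<open>cgf'\<close>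
  between 0 and \<open>s\<close>, hence positive and at most the chord slope on [s, u]. The ratio at
  \<open>u\<close> is a weighted mean of these two slopes.\<close>

lemma cgf_ratio_right:
  assumes "s \<in> I" "u \<in> I" "0 < s" "s \<le> u"
  shows "0 < cgf s / s" "cgf s / s \<le> cgf u / u"
proof -
  obtain t where t: "0 < t" "t < s" "t \<in> I" "cgf s - cgf 0 = (s - 0) * cgf' t"
    using cgf_MVT[of 0 s] assms zero_I by blast
  have *: "cgf s / s = cgf' t" using t assms by (simp add: cgf_0)
  show "0 < cgf s / s" using * cgf'_strict_mono[OF zero_I t(3,1)] by (simp add: cgf_0)
  show "cgf s / s \<le> cgf u / u"
  proof (cases "s = u")
    case False
    then obtain r where r: "s < r" "r \<in> I" "cgf u - cgf s = (u - s) * cgf' r"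
      using cgf_MVT[of s u] assms by (metis less_le)
    have "cgf s / s \<le> cgf' r" using * cgf'_strict_mono[of t r] t r by simp
    then have "cgf s + (u - s) * (cgf s / s) \<le> cgf u"
      using r(3) assms mult_left_mono[of "cgf s / s" "cgf' r" "u - s"] by linarith
    then show ?thesis using assms by (simp add: field_simps)
  qed simp
qed

lemma cgf_ratio_left:
  assumes "s \<in> I" "u \<in> I" "s < 0" "u \<le> s"
  shows "cgf s / s < 0" "cgf u / u \<le> cgf s / s"
proof -
  obtain t where t: "s < t" "t < 0" "t \<in> I" "cgf 0 - cgf s = (0 - s) * cgf' t"
    using cgf_MVT[of s 0] assms zero_I by blast
  have *: "cgf s / s = cgf' t" using t assms by (simp add: cgf_0)
  show "cgf s / s < 0" using * cgf'_strict_mono[OF t(3) zero_I t(2)] by (simp add: cgf_0)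
  show "cgf u / u \<le> cgf s / s"
  proof (cases "s = u")
    case False
    then obtain r where r: "r < s" "r \<in> I" "cgf s - cgf u = (s - u) * cgf' r"
      using cgf_MVT[of u s] assms by (metis less_le)
    have "cgf' r \<le> cgf s / s" using * cgf'_strict_mono[of r t] t r by simp
    then have "cgf s \<le> cgf u + (s - u) * (cgf s / s)"
      using r(3) assms mult_left_mono[of "cgf' r" "cgf s / s" "s - u"] by linarith
    then show ?thesis using assms by (simp add: field_simps)
  qed simp
qed

text \<open>The chords from 0 to \<open>s\<close> and to \<open>u\<close> have slopes on either side
  of \<epsilon>; the mean value theorem makes these slopes values of \<open>cgf'\<close>, and
  continuity does the rest.\<close>

lemma cgf'_root:
  assumes "s \<in> I" "u \<in> I" "s < 0" "0 < u" "cgf s / s < \<epsilon>" "\<epsilon> < cgf u / u"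
  shows "\<exists>z\<in>I. cgf' z = \<epsilon>"
proof -
  obtain t where t: "t < 0" "t \<in> I" "cgf 0 - cgf s = (0 - s) * cgf' t"
    using cgf_MVT[of s 0] assms zero_I by blast
  obtain r where r: "0 < r" "r \<in> I" "cgf u - cgf 0 = (u - 0) * cgf' r"
    using cgf_MVT[of 0 u] assms zero_I by blast
  have "cgf' t \<le> \<epsilon>" "\<epsilon> \<le> cgf' r" using t r assms by (simp_all add: cgf_0 field_simps)
  moreover have "continuous_on {t..r} cgf'"
    using between_in_I[OF t(2) r(2)] DERIV_isCont[OF DERIV_cgf']
    by (intro continuous_at_imp_continuous_on) auto
  ultimately obtain z where "t \<le> z" "z \<le> r" "cgf' z = \<epsilon>"
    using IVT'[of cgf' t \<epsilon> r] t r by auto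
  then show ?thesis using between_in_I[OF t(2) r(2)] by blast
qed

lemma cgf'_inj: "z \<in> I \<Longrightarrow> z' \<in> I \<Longrightarrow> cgf' z = cgf' z' \<Longrightarrow> z = z'"
  using cgf'_strict_mono[of z z'] cgf'_strict_mono[of z' z] by (cases z z' rule: linorder_cases) auto

lemma tilt_expansion:
  shows "(\<lambda>h. tilt 0 h - 1) \<in> O[nhds 0](\<lambda>h. h ^ 2)"
    and "(\<lambda>h. tilt 0 h - (1 + tilt 2 0 * h ^ 2 / 2 + tilt 3 0 * h ^ 3 / 6)) \<in> O[nhds 0](\<lambda>h. h ^ 4)"
    and "(\<lambda>h. tilt 1 h - (tilt 2 0 * h + tilt 3 0 * h ^ 2 / 2)) \<in> O[nhds 0](\<lambda>h. h ^ 3)"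
  using tilt_Taylor_bigo[OF zero_I, of 0 2] tilt_Taylor_bigo[OF zero_I, of 0 4] tilt_Taylor_bigo[OF zero_I, of 1 3]
    tilt_at_0(1,2)
  by (simp_all add: eval_nat_numeral mult_ac)

text \<open>With u = \<open>tilt 0 h - 1\<close> = O(h^2), the first-order estimate ln (1 + u) = u +
  O(u^2) already has an error of order h^4.\<close>

lemma cgf_expansion:
  "(\<lambda>h. cgf h - (tilt 2 0 * h ^ 2 / 2 + tilt 3 0 * h ^ 3 / 6)) \<in> O[nhds 0](\<lambda>h. h ^ 4)"
proof -
  have "(\<lambda>h::real. h ^ 2) \<in> o[nhds 0](\<lambda>_. 1)"
    by (intro smalloI_tendsto) (auto intro!: tendsto_eq_intros filterlim_ident)
  from landau_o.big_small_trans[OF tilt_expansion(1) this]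
  have "((\<lambda>h. tilt 0 h - 1) \<longlongrightarrow> 0) (nhds 0)" by (auto dest: smalloD_tendsto)
  \<comment> \<open>The range in which the quadratic bound for ln (1 + u) - u is available.\<close>
  then have "eventually (\<lambda>h. \<bar>tilt 0 h - 1\<bar> < 1 / 2) (nhds 0)"
    using tendstoD[of _ 0 _ "1/2 :: real"] by (fastforce simp: dist_real_def)
  then have "eventually (\<lambda>h. norm (cgf h - (tilt 0 h - 1)) \<le> 2 * norm ((tilt 0 h - 1) ^ 2)) (nhds 0)"
  proof eventually_elim
    case (elim h)
    then show ?case using abs_ln_one_plus_x_minus_x_bound[of "tilt 0 h - 1"] by (simp add: cgf_def)
  qed
  then have "(\<lambda>h. cgf h - (tilt 0 h - 1)) \<in> O[nhds 0](\<lambda>h. (tilt 0 h - 1) ^ 2)" by (rule bigoI)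
  also have "(\<lambda>h. (tilt 0 h - 1) ^ 2) \<in> O[nhds 0](\<lambda>h. (h ^ 2) ^ 2)"
    by (intro landau_o.big_power tilt_expansion)
  finally have "(\<lambda>h. cgf h - (tilt 0 h - 1)) \<in> O[nhds 0](\<lambda>h. h ^ 4)" by simp
  from sum_in_bigo(1)[OF this tilt_expansion(2)] show ?thesis
    by (simp add: algebra_simps)
qed

text \<open>Clearing the denominator, \<open>cgf' h - p h\<close> is (tilt 1 h - p h) - p h * (tilt
  0 h - 1) divided by \<open>tilt 0 h\<close>. Here p = O(h) and \<open>tilt 0 h - 1\<close> =
  O(h^2), and the denominator tends to 1.\<close>

lemma cgf'_expansion:
  "(\<lambda>h. cgf' h - (tilt 2 0 * h + tilt 3 0 * h ^ 2 / 2)) \<in> O[nhds 0](\<lambda>h. h ^ 3)"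
proof -
  define p where "p h = tilt 2 0 * h + tilt 3 0 * h ^ 2 / 2" for h
  have id: "(\<lambda>h::real. h) \<in> O[nhds 0](\<lambda>_. 1)"
    by (intro bigoI_tendsto[where c = 0]) (auto intro!: tendsto_eq_intros filterlim_ident)
  have "(\<lambda>h. tilt 2 0 + h * (tilt 3 0 / 2)) \<in> O[nhds 0](\<lambda>_. 1)"
    by (intro sum_in_bigo landau_o.big.mult_in_1 id) auto
  from landau_o.big.mult[OF landau_o.big_refl[of "\<lambda>h. h"] this]
  have p: "p \<in> O[nhds 0](\<lambda>h. h)" by (simp add: p_def[abs_def] algebra_simps power2_eq_square)
  have "(\<lambda>h. p h * (tilt 0 h - 1)) \<in> O[nhds 0](\<lambda>h. h ^ 3)"
    using landau_o.big.mult[OF p tilt_expansion(1)] by (simp add: eval_nat_numeral)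
  then have "(\<lambda>h. (tilt 1 h - p h) - p h * (tilt 0 h - 1)) \<in> O[nhds 0](\<lambda>h. h ^ 3)"
    unfolding p_def by (rule sum_in_bigo(2)[OF tilt_expansion(3)])
  moreover have "(tilt 0 \<longlongrightarrow> tilt 0 0) (nhds 0)"
    using DERIV_isCont[OF DERIV_tilt[OF zero_I, of 0]] by (simp add: isCont_def tendsto_at_iff_tendsto_nhds)
  then have "((\<lambda>h. inverse (tilt 0 h)) \<longlongrightarrow> inverse (tilt 0 0)) (nhds 0)"
    using tilt_at_0(1) by (intro tendsto_inverse) auto
  then have "(\<lambda>h. inverse (tilt 0 h)) \<in> O[nhds 0](\<lambda>_. 1)"
    by (intro bigoI_tendsto) auto
  ultimately have "(\<lambda>h. ((tilt 1 h - p h) - p h * (tilt 0 h - 1)) * inverse (tilt 0 h)) \<in> O[nhds 0](\<lambda>h. h ^ 3 * 1)"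
    by (rule landau_o.big.mult)
  moreover have "eventually (\<lambda>h. ((tilt 1 h - p h) - p h * (tilt 0 h - 1)) * inverse (tilt 0 h) = cgf' h - p h) (nhds 0)"
    using eventually_shift_in_I[OF zero_I]
  proof eventually_elim
    case (elim h)
    then show ?case using tilt_0_pos[of h] by (simp add: cgf'_def field_simps)
  qed
  ultimately show ?thesis unfolding p_def mult_1_right by (simp cong: landau_o.big.in_cong)
qed

text \<open>Strict monotonicity replaces continuity of the inverse: if \<epsilon> lies strictly
  between the values of \<open>cgf'\<close> at -\<eta> and \<eta>, then so does the root between
  -\<eta> and \<eta>.\<close>

lemma cgf'_root_tendsto_0:
  assumes "eventually (\<lambda>\<epsilon>. z \<epsilon> \<in> I \<and> cgf' (z \<epsilon>) = \<epsilon>) (at 0)"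
  shows "(z \<longlongrightarrow> 0) (at 0)"
proof (rule tendstoI)
  fix e :: real assume "e > 0"
  obtain d where d: "d > 0" "cball 0 d \<subseteq> I"
    using open_I zero_I open_contains_cball by blast
  define \<eta> where "\<eta> = min d (e / 2)"
  have \<eta>: "\<eta> > 0" "\<eta> < e" "\<eta> \<in> I" "- \<eta> \<in> I"
    using d \<open>e > 0\<close> by (auto simp: \<eta>_def subset_eq)
  define c where "c = min (cgf' \<eta>) (- cgf' (- \<eta>))"
  have c: "c > 0"
    using cgf'_strict_mono[OF zero_I \<eta>(3)] cgf'_strict_mono[OF \<eta>(4) zero_I] \<eta>(1) by (simp add: c_def cgf_0)
  have "eventually (\<lambda>\<epsilon>::real. \<bar>\<epsilon>\<bar> < c) (at 0)"
    using c by (auto simp: eventually_at dist_real_def)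
  with assms show "eventually (\<lambda>\<epsilon>. dist (z \<epsilon>) 0 < e) (at 0)"
  proof eventually_elim
    case (elim \<epsilon>)
    have "\<not> \<eta> \<le> z \<epsilon>" using cgf'_strict_mono[of \<eta> "z \<epsilon>"] elim \<eta> by (cases "\<eta> = z \<epsilon>") (auto simp: c_def)
    moreover have "\<not> z \<epsilon> \<le> - \<eta>" using cgf'_strict_mono[of "z \<epsilon>" "- \<eta>"] elim \<eta> by (cases "z \<epsilon> = - \<eta>") (auto simp: c_def)
    ultimately show ?case using \<eta>(2) by (auto simp: dist_real_def)
  qed
qed

text \<open>At the root, \<epsilon> * z - cgf z is the Legendre transform of \<open>cgf\<close>.
  Composing the expansions at 0 with the root brings the problem into the form of
  \<open>asymptotic_inversion\<close>.\<close>

lemma Legendre_expansion: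
  assumes z: "eventually (\<lambda>\<epsilon>. z \<epsilon> \<in> I \<and> cgf' (z \<epsilon>) = \<epsilon>) (at 0)"
  shows "(\<lambda>\<epsilon>. cgf (z \<epsilon>) - \<epsilon> * z \<epsilon> - (- (\<epsilon>^2) / (2 * tilt 2 0) + tilt 3 0 * \<epsilon>^3 / (6 * tilt 2 0 ^ 3)))
      \<in> O[at 0](\<lambda>\<epsilon>. \<epsilon> ^ 4)" (is ?A)
    and "(\<lambda>\<epsilon>. cgf (z \<epsilon>) / z \<epsilon> / (\<epsilon> / 2) - (1 - tilt 3 0 * \<epsilon> / (6 * tilt 2 0 ^ 2)))
      \<in> O[at 0](\<lambda>\<epsilon>. \<epsilon> ^ 2)" (is ?B)
proof -
  note z0 = cgf'_root_tendsto_0[OF z]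
  have nz: "eventually (\<lambda>\<epsilon>::real. \<epsilon> \<noteq> 0) (at 0)" by (simp add: eventually_at_filter)
  have znz: "eventually (\<lambda>\<epsilon>. z \<epsilon> \<noteq> 0) (at 0)"
    using z nz by eventually_elim (auto simp: cgf_0)
  have "(\<lambda>\<epsilon>. cgf' (z \<epsilon>) - (tilt 2 0 * z \<epsilon> + tilt 3 0 * z \<epsilon> ^ 2 / 2)) \<in> O[at 0](\<lambda>\<epsilon>. z \<epsilon> ^ 3)"
    using landau_o.big.compose[OF cgf'_expansion z0] .
  then have E: "(\<lambda>\<epsilon>. \<epsilon> - (tilt 2 0 * z \<epsilon> + tilt 3 0 * z \<epsilon> ^ 2 / 2)) \<in> O[at 0](\<lambda>\<epsilon>. z \<epsilon> ^ 3)"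
    by (subst landau_o.big.in_cong[where g = "\<lambda>\<epsilon>. cgf' (z \<epsilon>) - (tilt 2 0 * z \<epsilon> + tilt 3 0 * z \<epsilon> ^ 2 / 2)"])
       (use z in \<open>eventually_elim, simp\<close>)
  have v: "tilt 2 0 > 0" using variance_pos by (simp add: tilt_at_0(3))
  show ?A ?B
    using asymptotic_inversion[OF v z0 znz E landau_o.big.compose[OF cgf_expansion z0]] by auto
qed

end

section \<open>The maximal inequality for the centred sums\<close>

text \<open>Subtracting \<open>L\<close> from each exponent normalises the factors to mean 1. The
  event says, up to attainment of the supremum, that their product reaches the level exp (m *
  (\<epsilon> * s - L)), and Ville's inequality bounds its probability by the inverse of that
  level.\<close>

lemma (in prob_space) exponential_maximal_inequality:
  fixes Y :: "nat \<Rightarrow> 'a \<Rightarrow> real" and s \<mu> \<epsilon> :: real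
  defines "L \<equiv> ln (expectation (\<lambda>x. exp (s * (Y 1 x - \<mu>))))"
  assumes rv: "\<And>i. i \<ge> 1 \<Longrightarrow> Y i \<in> borel_measurable M"
    and indep: "indep_vars (\<lambda>_. borel) Y {1..}"
    and ident: "\<And>i. i \<ge> 1 \<Longrightarrow> distr M borel (Y i) = distr M borel (Y 1)"
    and int: "integrable M (\<lambda>x. exp (s * (Y 1 x - \<mu>)))"
  shows "prob {x \<in> space M. (SUP n\<in>{1..}. ereal (s * ((\<Sum>i=1..n. Y i x - \<mu>) - real m * \<epsilon>)
      - L * (real n - real m))) \<ge> 0} \<le> exp (L - \<epsilon> * s) ^ m" (is "prob ?E \<le> _")
proof -
  define Z where "Z i x = ennreal (exp (s * (Y i x - \<mu>) - L))" for i x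
  have E_pos: "expectation (\<lambda>x. exp (s * (Y 1 x - \<mu>))) > 0"
    using integral_less_AE_space[of "\<lambda>_. 0" "\<lambda>x. exp (s * (Y 1 x - \<mu>))"] int
    by (simp add: emeasure_space_1)
  have indep_Z: "indep_vars (\<lambda>_. borel) Z {1..}"
    unfolding Z_def by (rule indep_vars_compose2[OF indep]) measurable
  have mean: "(\<integral>\<^sup>+x. Z i x \<partial>M) = 1" if i: "i \<ge> 1" for i
  proof -
    have "(\<integral>\<^sup>+x. Z i x \<partial>M) = (\<integral>\<^sup>+y. ennreal (exp (s * (y - \<mu>) - L)) \<partial>distr M borel (Y i))"
      unfolding Z_def using rv[OF i] by (subst nn_integral_distr) auto
    also have "\<dots> = (\<integral>\<^sup>+x. ennreal (exp (s * (Y 1 x - \<mu>) - L)) \<partial>M)"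
      unfolding ident[OF i] using rv[of 1] by (subst nn_integral_distr) auto
    also have "\<dots> = ennreal (expectation (\<lambda>x. exp (s * (Y 1 x - \<mu>) - L)))"
      using int by (intro nn_integral_eq_integral) (auto simp: exp_diff)
    also have "expectation (\<lambda>x. exp (s * (Y 1 x - \<mu>) - L)) = 1"
      using E_pos by (simp add: exp_diff L_def)
    finally show ?thesis by simp
  qed
  have prod_Z: "(\<Prod>i=1..n. Z i x) = ennreal (exp (s * (\<Sum>i=1..n. Y i x - \<mu>) - L * real n))" for n x
  proof -
    have "(\<Sum>i=1..n. s * (Y i x - \<mu>) - L) = s * (\<Sum>i=1..n. Y i x - \<mu>) - L * real n"
      unfolding sum_subtractf[of "\<lambda>i. s * (Y i x - \<mu>)"] sum_distrib_left by simp
    then show ?thesis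
      unfolding Z_def by (simp add: prod_ennreal exp_sum[symmetric])
  qed
  \<comment> \<open>A supremum equal to 0 need not be attained. A slack \<delta> > 0 gives an index
    with value above -\<delta>, and \<delta> tends to 0 at the end.\<close>
  have bound: "prob ?E \<le> exp (L - \<epsilon> * s) ^ m * exp \<delta>" if \<delta>: "\<delta> > 0" for \<delta>
  proof -
    define c where "c = exp (L - \<epsilon> * s) ^ m * exp \<delta>"
    let ?A = "{x \<in> space M. \<exists>n. 1 \<le> ennreal c * (\<Prod>i=1..n. Z i x)}"
    have [measurable]: "(\<lambda>x. \<Prod>i=1..n. Z i x) \<in> borel_measurable M" for n
      using rv by (intro borel_measurable_prod_ennreal) (auto simp: Z_def)
    have c: "c = exp (real m * (L - \<epsilon> * s) + \<delta>)"
      by (simp add: c_def exp_add exp_of_nat_mult)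
    have "?E \<subseteq> ?A"
    proof safe
      fix x assume "x \<in> space M" and sup: "0 \<le> (SUP n\<in>{1..}. ereal (s * ((\<Sum>i=1..n. Y i x - \<mu>) - real m * \<epsilon>)
          - L * (real n - real m)))"
      have "ereal (- \<delta>) < 0" using \<delta> by simp
      also note sup
      finally obtain n where "ereal (- \<delta>) < ereal (s * ((\<Sum>i=1..n. Y i x - \<mu>) - real m * \<epsilon>) - L * (real n - real m))"
        unfolding less_SUP_iff by blast
      then have "0 \<le> (real m * (L - \<epsilon> * s) + \<delta>) + (s * (\<Sum>i=1..n. Y i x - \<mu>) - L * real n)"
        by (simp add: algebra_simps)
      then have "1 \<le> c * exp (s * (\<Sum>i=1..n. Y i x - \<mu>) - L * real n)"
        unfolding c exp_add[symmetric] by simp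
      then show "\<exists>n. 1 \<le> ennreal c * (\<Prod>i=1..n. Z i x)"
        unfolding prod_Z by (intro exI[of _ n]) (simp add: c_def ennreal_mult[symmetric] ennreal_1[symmetric] del: ennreal_1)
    qed
    then have "emeasure M ?E \<le> emeasure M ?A" by (rule emeasure_mono) measurable
    also have "\<dots> \<le> ennreal c" by (rule Ville_inequality[OF indep_Z mean])
    finally show ?thesis
      unfolding c_def[symmetric] emeasure_eq_measure by (simp add: c_def)
  qed
  have "((\<lambda>\<delta>. exp (L - \<epsilon> * s) ^ m * exp \<delta>) \<longlongrightarrow> exp (L - \<epsilon> * s) ^ m * exp 0) (at_right 0)"
    by (intro tendsto_intros)
  then have "prob ?E \<le> exp (L - \<epsilon> * s) ^ m * exp 0"
    by (rule tendsto_lowerbound) (use bound in \<open>simp_all add: eventually_at_filter\<close>)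
  then show ?thesis by simp
qed

section \<open>Integrability from exponential moments, and behaviour near the endpoints\<close>

text \<open>The hypotheses place \<open>s\<close> between 0 and \<open>t\<close>, on either side of
  0, so exp (s * y) is at most 1 or at most exp (t * y) according to the sign of s * y.\<close>

lemma (in prob_space) integrable_exp_mono:
  fixes U :: "'a \<Rightarrow> real"
  assumes [measurable]: "U \<in> borel_measurable M"
    and int: "integrable M (\<lambda>x. exp (t * U x))" and "0 \<le> s * t" "\<bar>s\<bar> \<le> \<bar>t\<bar>"
  shows "integrable M (\<lambda>x. exp (s * U x))"
proof (rule Bochner_Integration.integrable_bound)
  show "integrable M (\<lambda>x. 1 + exp (t * U x))" using int by simp
  have "exp (s * y) \<le> 1 + exp (t * y)" for y :: real
  proof (cases "s * y \<le> 0")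
    case True
    then have "exp (s * y) \<le> 1" by simp
    then show ?thesis using exp_ge_zero[of "t * y"] by linarith
  next
    case False
    then have "s * y \<le> t * y"
      using assms(3,4) by (cases "s > 0"; cases "y > 0")
        (auto simp: zero_le_mult_iff mult_le_0_iff intro: mult_right_mono mult_right_mono_neg)
    then have "exp (s * y) \<le> exp (t * y)" by simp
    then show ?thesis by linarith
  qed
  then show "AE x in M. norm (exp (s * U x)) \<le> norm (1 + exp (t * U x))" by simp
qed measurable

text \<open>Exponentials at d and -d dominate d * |y|. This makes the mean of \<open>Y 1\<close> a
  genuine integral, so that subtracting it centres the variable.\<close>

lemma (in prob_space) integrable_from_exp:
  fixes U :: "'a \<Rightarrow> real"
  assumes [measurable]: "U \<in> borel_measurable M"
    and "open I" "0 \<in> I" and int: "\<And>s. s \<in> I \<Longrightarrow> integrable M (\<lambda>x. exp (s * U x))"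
  shows "integrable M U"
proof -
  obtain d where d: "d > 0" "cball 0 d \<subseteq> I"
    using \<open>open I\<close> \<open>0 \<in> I\<close> open_contains_cball by blast
  then have dI: "d \<in> I" "- d \<in> I" by (auto simp: subset_eq)
  have "\<bar>y\<bar> \<le> \<bar>(exp (d * y) + exp (- d * y)) / d\<bar>" for y
  proof -
    have "d * y \<le> exp (d * y)" "- d * y \<le> exp (- d * y)"
      using exp_ge_add_one_self[of "d * y"] exp_ge_add_one_self[of "- d * y"] by linarith+
    then have "d * y \<le> exp (d * y) + exp (- d * y)" "- d * y \<le> exp (d * y) + exp (- d * y)"
      using exp_gt_zero[of "d * y"] exp_gt_zero[of "- d * y"] by linarith+
    then have "d * \<bar>y\<bar> \<le> exp (d * y) + exp (- d * y)" by (simp add: abs_if)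
    then have "\<bar>y\<bar> \<le> (exp (d * y) + exp (- d * y)) / d" using d(1) by (simp add: field_simps)
    then show ?thesis by linarith
  qed
  then have bound: "AE x in M. norm (U x) \<le> norm ((exp (d * U x) + exp (- d * U x)) / d)" by simp
  have "integrable M (\<lambda>x. (exp (d * U x) + exp (- d * U x)) / d)"
    using int[OF dI(1)] int[OF dI(2)] by simp
  then show ?thesis by (rule Bochner_Integration.integrable_bound[OF _ _ bound]) measurable
qed

lemma eventually_from_below:
  assumes "ereal u < b"
  shows "eventually (\<lambda>s. u \<le> s \<and> ereal s < b) (from_below b)"
proof (cases b)
  case (real r)
  then show ?thesis using assms
    by (auto simp: from_below_def eventually_at_left_field intro!: exI[of _ u])
next
  case PInf
  then show ?thesis by (simp add: from_below_def eventually_ge_at_top)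
qed (use assms in auto)

lemma eventually_from_above:
  assumes "a < ereal u"
  shows "eventually (\<lambda>s. s \<le> u \<and> a < ereal s) (from_above a)"
proof (cases a)
  case (real r)
  then show ?thesis using assms
    by (auto simp: from_above_def eventually_at_right_field intro!: exI[of _ u])
next
  case MInf
  then show ?thesis by (simp add: from_above_def eventually_le_at_bot)
qed (use assms in auto)

lemma from_below_neq_bot: "from_below b \<noteq> bot" and from_above_neq_bot: "from_above a \<noteq> bot"
  by (simp_all add: from_below_def from_above_def)

section \<open>The three assertions for the i.i.d. sequence\<close>

theorem theorem14:
  fixes M :: "'a measure" and Y :: "nat \<Rightarrow> 'a \<Rightarrow> real"
    and a b :: ereal and \<mu> \<sigma> \<nu> :: real
    and \<phi> :: "real \<Rightarrow> real" and X :: "nat \<Rightarrow> 'a \<Rightarrow> real"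
    and La Lb :: ereal and m :: nat
  assumes "prob_space M"
    and rv: "\<forall>i\<ge>1. Y i \<in> borel_measurable M"
    and indep: "prob_space.indep_vars M (\<lambda>_. borel) Y {1..}"
    and ident: "\<forall>i\<ge>1. distr M borel (Y i) = distr M borel (Y 1)"
    and a_def: "a = Inf (ereal ` {s. s < 0 \<and> (\<integral>\<^sup>+x. ennreal (exp (s * Y 1 x)) \<partial>M) < \<infinity>})"
    and b_def: "b = Sup (ereal ` {s. s > 0 \<and> (\<integral>\<^sup>+x. ennreal (exp (s * Y 1 x)) \<partial>M) < \<infinity>})"
    and "a < 0" and "b > 0"
    and mu_def: "\<mu> = prob_space.expectation M (Y 1)"
    and sigma_def: "\<sigma> = sqrt (prob_space.expectation M (\<lambda>x. \<bar>Y 1 x - \<mu>\<bar>^2))"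
    and nu_def: "\<nu> = prob_space.expectation M (\<lambda>x. (Y 1 x - \<mu>)^3)"
    and "\<sigma> > 0"
    and phi_def: "\<forall>s. \<phi> s = ln (prob_space.expectation M (\<lambda>x. exp (s * (Y 1 x - \<mu>))))"
    and X_def: "\<forall>n x. X n x = (\<Sum>i=1..n. Y i x - \<mu>)"
    and La: "((\<lambda>s. ereal (\<phi> s / s)) \<longlongrightarrow> La) (from_above a)"
    and Lb: "((\<lambda>s. ereal (\<phi> s / s)) \<longlongrightarrow> Lb) (from_below b)"
    and "m \<ge> 1"
  shows
    "(\<forall>\<epsilon>. La < ereal \<epsilon> \<and> ereal \<epsilon> < Lb \<longrightarrow>
       (\<forall>s. a < ereal s \<and> ereal s < b \<longrightarrow>
          prob_space.prob M {x \<in> space M.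
             (SUP n\<in>{1..}. ereal (s * (X n x - real m * \<epsilon>) - \<phi> s * (real n - real m))) \<ge> 0}
          \<le> (exp (\<phi> s - \<epsilon> * s)) ^ m))
    \<and> (\<forall>\<epsilon>. La < ereal \<epsilon> \<and> ereal \<epsilon> < Lb \<longrightarrow>
       (\<exists>!z. a < ereal z \<and> ereal z < b \<and> (\<phi> has_real_derivative \<epsilon>) (at z)))
    \<and> (\<forall>\<zeta>. (\<forall>\<epsilon>. La < ereal \<epsilon> \<and> ereal \<epsilon> < Lb \<longrightarrow>
             a < ereal (\<zeta> \<epsilon>) \<and> ereal (\<zeta> \<epsilon>) < b \<and> (\<phi> has_real_derivative \<epsilon>) (at (\<zeta> \<epsilon>))) \<longrightarrow>
       (\<forall>\<epsilon>. La < ereal \<epsilon> \<and> ereal \<epsilon> < Lb \<longrightarrow>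
          prob_space.prob M {x \<in> space M.
             (SUP n\<in>{1..}. ereal (\<zeta> \<epsilon> * (X n x - real m * \<epsilon>) - \<phi> (\<zeta> \<epsilon>) * (real n - real m))) \<ge> 0}
          \<le> (exp (\<phi> (\<zeta> \<epsilon>) - \<epsilon> * \<zeta> \<epsilon>)) ^ m)
     \<and> (\<lambda>\<epsilon>. (exp (\<phi> (\<zeta> \<epsilon>) - \<epsilon> * \<zeta> \<epsilon>)) ^ m
              / (exp (- (\<epsilon>^2) / (2 * \<sigma>^2) + \<nu> * \<epsilon>^3 / (6 * \<sigma>^6))) ^ m - 1)
         \<in> O[at 0](\<lambda>\<epsilon>. \<epsilon>^4)
     \<and> (\<lambda>\<epsilon>. (exp (- (\<epsilon>^2) / (2 * \<sigma>^2) + \<nu> * \<epsilon>^3 / (6 * \<sigma>^6))) ^ m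
              / (exp (- (\<epsilon>^2) / (2 * \<sigma>^2))) ^ m - 1)
         \<in> O[at 0](\<lambda>\<epsilon>. \<epsilon>^3)
     \<and> (\<lambda>\<epsilon>. (exp (\<phi> (\<zeta> \<epsilon>) - \<epsilon> * \<zeta> \<epsilon>)) ^ m
              / (exp (- (\<epsilon>^2) / (2 * \<sigma>^2))) ^ m - 1)
         \<in> O[at 0](\<lambda>\<epsilon>. \<epsilon>^3)
     \<and> (\<lambda>\<epsilon>. \<phi> (\<zeta> \<epsilon>) / \<zeta> \<epsilon> / (\<epsilon> / 2) - (1 - \<nu> * \<epsilon> / (6 * \<sigma>^4)))
         \<in> O[at 0](\<lambda>\<epsilon>. \<epsilon>^2)
     \<and> (\<lambda>\<epsilon>. \<phi> (\<zeta> \<epsilon>) / \<zeta> \<epsilon> / (\<epsilon> / 2) - 1)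
         \<in> O[at 0](\<lambda>\<epsilon>. \<epsilon>))"
proof -
  interpret prob_space M by fact
  note rv = rv[rule_format] and ident = ident[rule_format]
  define I where "I = {s. a < ereal s \<and> ereal s < b}"
  define W where "W x = Y 1 x - \<mu>" for x
  have [measurable]: "Y 1 \<in> borel_measurable M" "Y (Suc 0) \<in> borel_measurable M" using rv[of 1] by simp_all

  have open_I: "open I"
  proof -
    have "I = ereal -` {a<..<b}" by (auto simp: I_def)
    then show ?thesis by (simp add: open_ereal_vimage)
  qed
  have interval_I: "is_interval I"
    unfolding is_interval_1 I_def
    by (auto intro: less_le_trans le_less_trans simp: less_le_trans[of a "ereal _" "ereal _"] le_less_trans[of "ereal _" "ereal _" b])
  have zero_I: "0 \<in> I" using \<open>a < 0\<close> \<open>b > 0\<close> by (simp add: I_def zero_ereal_def)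

  have int_Y: "integrable M (\<lambda>x. exp (s * Y 1 x))" if s: "s \<in> I" for s
  proof -
    \<comment> \<open>An infimum or supremum only supplies some exponent \<open>t\<close> beyond
      \<open>s\<close> with a finite integral; integrability at \<open>s\<close> itself follows by
      comparison.\<close>
    obtain t where t: "(\<integral>\<^sup>+x. ennreal (exp (t * Y 1 x)) \<partial>M) < \<infinity>" "s * t \<ge> 0" "\<bar>s\<bar> \<le> \<bar>t\<bar>"
    proof (cases s "0::real" rule: linorder_cases)
      case less
      have "a < ereal s" using s by (simp add: I_def)
      then obtain t where "t < 0" "(\<integral>\<^sup>+x. ennreal (exp (t * Y 1 x)) \<partial>M) < \<infinity>" "t < s"
        unfolding a_def Inf_less_iff by auto
      with less show ?thesis by (intro that[of t]) (auto simp: mult_nonpos_nonpos)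
    next
      case equal
      then show ?thesis by (intro that[of 0]) (auto simp: emeasure_space_1)
    next
      case greater
      have "ereal s < b" using s by (simp add: I_def)
      then obtain t where "t > 0" "(\<integral>\<^sup>+x. ennreal (exp (t * Y 1 x)) \<partial>M) < \<infinity>" "s < t"
        unfolding b_def less_Sup_iff by auto
      with greater show ?thesis by (intro that[of t]) auto
    qed
    have "integrable M (\<lambda>x. exp (t * Y 1 x))"
      using t(1) by (intro integrableI_nonneg) auto
    then show ?thesis using t(2,3) by (rule integrable_exp_mono[rotated]) measurable
  qed
  have int_Y1: "integrable M (Y 1)"
    using open_I zero_I int_Y by (rule integrable_from_exp[rotated]) measurable
  have int_W: "integrable M (\<lambda>x. exp (s * W x))" if "s \<in> I" for s
    using int_Y[OF that] by (simp add: W_def right_diff_distrib exp_diff)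
  have "0 < expectation (\<lambda>x. \<bar>Y 1 x - \<mu>\<bar>\<^sup>2)" using \<open>\<sigma> > 0\<close> unfolding sigma_def by simp
  then have var: "0 < expectation (\<lambda>x. (W x)\<^sup>2)" by (simp add: W_def)
  interpret centered_mgf M W I
  proof
    show "W \<in> borel_measurable M" by (simp add: W_def[abs_def])
    show "expectation W = 0" using int_Y1 by (simp add: W_def[abs_def] mu_def prob_space)
  qed (use open_I interval_I zero_I int_W var in auto)

  have phi: "\<phi> = cgf" using phi_def by (simp add: fun_eq_iff cgf_def tilt_def W_def)
  have v: "tilt 2 0 = \<sigma>\<^sup>2" using var by (simp add: tilt_def sigma_def W_def)
  have n: "tilt 3 0 = \<nu>" by (simp add: tilt_def nu_def W_def)
  have DERIV_phi_iff: "(\<phi> has_real_derivative \<epsilon>) (at z) \<longleftrightarrow> cgf' z = \<epsilon>" if "z \<in> I" for z \<epsilon>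
    unfolding phi using DERIV_cgf[OF that] DERIV_unique[of cgf] by blast

  obtain d where d: "d > 0" "cball 0 d \<subseteq> I"
    using open_I zero_I unfolding open_contains_cball by blast
  then have dI: "d \<in> I" "- d \<in> I" by (auto simp: subset_eq)
  have ev_b: "eventually (\<lambda>s. d \<le> s \<and> s \<in> I) (from_below b)"
  proof -
    have "ereal d < b" using dI by (simp add: I_def)
    from eventually_from_below[OF this] show ?thesis
    proof eventually_elim
      case (elim s)
      then have "a < ereal s" using dI(1) less_le_trans[of a "ereal d" "ereal s"] by (simp add: I_def)
      with elim show ?case by (simp add: I_def)
    qed
  qed
  have ev_a: "eventually (\<lambda>s. s \<le> - d \<and> s \<in> I) (from_above a)"
  proof -
    have "a < ereal (- d)" using dI(2) by (simp add: I_def)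
    from eventually_from_above[OF this] show ?thesis
    proof eventually_elim
      case (elim s)
      then have "ereal s < b" using dI(2) le_less_trans[of "ereal s" "ereal (- d)" b] by (simp add: I_def)
      with elim show ?case by (simp add: I_def)
    qed
  qed
  \<comment> \<open>The ratio is positive at \<open>d\<close> and increases towards
    \<open>b\<close>, so its limit is positive; symmetrically the limit at \<open>a\<close> is
    negative. Hence all \<epsilon> near 0 are admissible, as the asymptotics require.\<close>
  have "0 < ereal (cgf d / d)" using cgf_ratio_right(1)[of d d] d dI by simp
  moreover have "eventually (\<lambda>s. ereal (cgf d / d) \<le> ereal (\<phi> s / s)) (from_below b)"
    using ev_b by eventually_elim (use cgf_ratio_right(2)[OF dI(1)] d(1) in \<open>simp add: phi\<close>)
  then have "ereal (cgf d / d) \<le> Lb"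
    by (rule tendsto_lowerbound[OF Lb _ from_below_neq_bot])
  ultimately have Lb_pos: "0 < Lb" by (rule less_le_trans)
  have "eventually (\<lambda>s. ereal (\<phi> s / s) \<le> ereal (cgf (- d) / - d)) (from_above a)"
    using ev_a by eventually_elim
      (use cgf_ratio_left(2)[OF dI(2)] d(1) in \<open>simp add: phi del: divide_minus_right\<close>)
  then have "La \<le> ereal (cgf (- d) / - d)"
    by (rule tendsto_upperbound[OF La _ from_above_neq_bot])
  also have "\<dots> < 0" using cgf_ratio_left(1)[of "- d" "- d"] d dI by simp
  finally have La_neg: "La < 0" .

  have i: "prob {x \<in> space M. (SUP n\<in>{1..}. ereal (s * (X n x - real m * \<epsilon>) - \<phi> s * (real n - real m))) \<ge> 0}
      \<le> exp (\<phi> s - \<epsilon> * s) ^ m" if "s \<in> I" for s \<epsilon>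
    unfolding X_def[rule_format] phi_def[rule_format]
    using exponential_maximal_inequality[OF rv indep ident, of s \<mu> m \<epsilon>] int_W[OF that] by (simp add: W_def)

  have ii: "\<exists>!z. a < ereal z \<and> ereal z < b \<and> (\<phi> has_real_derivative \<epsilon>) (at z)"
    if \<epsilon>: "La < ereal \<epsilon>" "ereal \<epsilon> < Lb" for \<epsilon>
  proof -
    \<comment> \<open>Near the two endpoints the ratio lies on opposite sides of \<epsilon>, which
      supplies the two chords for the intermediate value argument.\<close>
    have "eventually (\<lambda>s. ereal \<epsilon> < ereal (\<phi> s / s)) (from_below b)" using order_tendstoD(1)[OF Lb \<epsilon>(2)] .
    from eventually_happens'[OF from_below_neq_bot eventually_conj[OF this ev_b]]
    obtain u where u: "u \<in> I" "0 < u" "\<epsilon> < cgf u / u" using d(1) by (auto simp: phi)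
    have "eventually (\<lambda>s. ereal (\<phi> s / s) < ereal \<epsilon>) (from_above a)" using order_tendstoD(2)[OF La \<epsilon>(1)] .
    from eventually_happens'[OF from_above_neq_bot eventually_conj[OF this ev_a]]
    obtain s where s: "s \<in> I" "s < 0" "cgf s / s < \<epsilon>" using d(1) by (auto simp: phi)
    obtain z where "z \<in> I" "cgf' z = \<epsilon>" using cgf'_root[OF s(1) u(1) s(2) u(2) s(3) u(3)] by blast
    then have "\<exists>!z. z \<in> I \<and> cgf' z = \<epsilon>" using cgf'_inj by blast
    then show ?thesis using DERIV_phi_iff unfolding I_def by (simp cong: conj_cong)
  qed

  have near_0: "eventually (\<lambda>\<epsilon>. La < ereal \<epsilon> \<and> ereal \<epsilon> < Lb) (at 0)"
  proof -
    have "(ereal \<longlongrightarrow> ereal 0) (at 0)" by (intro tendsto_intros)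
    from order_tendstoD(1)[OF this, of La] order_tendstoD(2)[OF this, of Lb] show ?thesis
      using La_neg Lb_pos by (simp add: zero_ereal_def eventually_conj_iff)
  qed

  have iii: "(\<lambda>\<epsilon>. (exp (\<phi> (\<zeta> \<epsilon>) - \<epsilon> * \<zeta> \<epsilon>)) ^ m
              / (exp (- (\<epsilon>^2) / (2 * \<sigma>^2) + \<nu> * \<epsilon>^3 / (6 * \<sigma>^6))) ^ m - 1)
         \<in> O[at 0](\<lambda>\<epsilon>. \<epsilon>^4)" (is ?A)
     "(\<lambda>\<epsilon>. (exp (- (\<epsilon>^2) / (2 * \<sigma>^2) + \<nu> * \<epsilon>^3 / (6 * \<sigma>^6))) ^ m
              / (exp (- (\<epsilon>^2) / (2 * \<sigma>^2))) ^ m - 1)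
         \<in> O[at 0](\<lambda>\<epsilon>. \<epsilon>^3)" (is ?B)
     "(\<lambda>\<epsilon>. (exp (\<phi> (\<zeta> \<epsilon>) - \<epsilon> * \<zeta> \<epsilon>)) ^ m
              / (exp (- (\<epsilon>^2) / (2 * \<sigma>^2))) ^ m - 1)
         \<in> O[at 0](\<lambda>\<epsilon>. \<epsilon>^3)" (is ?C)
     "(\<lambda>\<epsilon>. \<phi> (\<zeta> \<epsilon>) / \<zeta> \<epsilon> / (\<epsilon> / 2) - (1 - \<nu> * \<epsilon> / (6 * \<sigma>^4)))
         \<in> O[at 0](\<lambda>\<epsilon>. \<epsilon>^2)" (is ?D)
     "(\<lambda>\<epsilon>. \<phi> (\<zeta> \<epsilon>) / \<zeta> \<epsilon> / (\<epsilon> / 2) - 1)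
         \<in> O[at 0](\<lambda>\<epsilon>. \<epsilon>)" (is ?E)
    if "\<forall>\<epsilon>. La < ereal \<epsilon> \<and> ereal \<epsilon> < Lb \<longrightarrow>
             a < ereal (\<zeta> \<epsilon>) \<and> ereal (\<zeta> \<epsilon>) < b \<and> (\<phi> has_real_derivative \<epsilon>) (at (\<zeta> \<epsilon>))" for \<zeta>
  proof -
    have z: "eventually (\<lambda>\<epsilon>. \<zeta> \<epsilon> \<in> I \<and> cgf' (\<zeta> \<epsilon>) = \<epsilon>) (at 0)"
      using near_0
    proof eventually_elim
      case (elim \<epsilon>)
      then have "\<zeta> \<epsilon> \<in> I" "(\<phi> has_real_derivative \<epsilon>) (at (\<zeta> \<epsilon>))" using that by (auto simp: I_def)
      then show ?case using DERIV_phi_iff by simp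
    qed
    have pow: "(\<sigma>\<^sup>2) ^ 3 = \<sigma> ^ 6" "(\<sigma>\<^sup>2)\<^sup>2 = \<sigma> ^ 4" by simp_all
    note exps = Legendre_expansion[OF z, unfolded v n pow phi[symmetric]]
    have mono: "(\<lambda>\<epsilon>::real. \<epsilon> ^ k) \<in> O[at 0](\<lambda>\<epsilon>. \<epsilon> ^ j)" if "j \<le> k" for j k
    proof (rule bigoI[of _ 1])
      have "eventually (\<lambda>\<epsilon>::real. \<bar>\<epsilon>\<bar> < 1) (at 0)" by (auto simp: eventually_at dist_real_def intro: exI[of _ 1])
      then show "eventually (\<lambda>\<epsilon>::real. norm (\<epsilon> ^ k) \<le> 1 * norm (\<epsilon> ^ j)) (at 0)"
        by eventually_elim (use that in \<open>auto simp: power_abs intro!: power_decreasing\<close>)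
    qed
    show ?A using exp_power_ratio_bigo[OF exps(1)] by simp
    \<comment> \<open>The case \<nu> = 0 is separate because only a nonzero constant factor can be
      cancelled; otherwise the function vanishes.\<close>
    have cubic: "(\<lambda>\<epsilon>. \<nu> * \<epsilon> ^ 3 / (6 * \<sigma> ^ 6)) \<in> O[at 0](\<lambda>\<epsilon>. \<epsilon> ^ 3)"
      by (cases "\<nu> = 0") (use \<open>\<sigma> > 0\<close> in auto)
    have "(\<lambda>\<epsilon>. (- (\<epsilon>^2) / (2 * \<sigma>^2) + \<nu> * \<epsilon>^3 / (6 * \<sigma>^6)) - (- (\<epsilon>^2) / (2 * \<sigma>^2))) \<in> O[at 0](\<lambda>\<epsilon>. \<epsilon> ^ 3)"
      using cubic by simp
    from exp_power_ratio_bigo[OF this] show ?B by simp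
    \<comment> \<open>The fourth-order error is relaxed to third order and the cubic term is moved
      into it.\<close>
    have "(\<lambda>\<epsilon>. (\<phi> (\<zeta> \<epsilon>) - \<epsilon> * \<zeta> \<epsilon>) - (- (\<epsilon>^2) / (2 * \<sigma>^2))) \<in> O[at 0](\<lambda>\<epsilon>. \<epsilon> ^ 3)"
      using sum_in_bigo(1)[OF landau_o.big_trans[OF exps(1) mono] cubic] by (simp add: algebra_simps)
    from exp_power_ratio_bigo[OF this] show ?C by simp
    show ?D by (rule exps(2))
    have lin: "(\<lambda>\<epsilon>. \<nu> * \<epsilon> / (6 * \<sigma> ^ 4)) \<in> O[at 0](\<lambda>\<epsilon>. \<epsilon>)"
      by (cases "\<nu> = 0") (use \<open>\<sigma> > 0\<close> in auto)
    have "(\<lambda>\<epsilon>. \<phi> (\<zeta> \<epsilon>) / \<zeta> \<epsilon> / (\<epsilon> / 2) - (1 - \<nu> * \<epsilon> / (6 * \<sigma>^4))) \<in> O[at 0](\<lambda>\<epsilon>. \<epsilon>)"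
      using landau_o.big_trans[OF exps(2) mono[of 1 2]] by simp
    from sum_in_bigo(2)[OF this lin] show ?E by (simp add: algebra_simps)
  qed

  show ?thesis
  proof (intro conjI allI impI; (elim conjE)?)
    fix \<epsilon> s assume "a < ereal s" "ereal s < b"
    then show "prob {x \<in> space M. (SUP n\<in>{1..}. ereal (s * (X n x - real m * \<epsilon>) - \<phi> s * (real n - real m))) \<ge> 0}
      \<le> exp (\<phi> s - \<epsilon> * s) ^ m" by (intro i) (simp add: I_def)
  next
    fix \<epsilon> \<zeta> assume "\<forall>\<epsilon>. La < ereal \<epsilon> \<and> ereal \<epsilon> < Lb \<longrightarrow>
             a < ereal (\<zeta> \<epsilon>) \<and> ereal (\<zeta> \<epsilon>) < b \<and> (\<phi> has_real_derivative \<epsilon>) (at (\<zeta> \<epsilon>))"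
      and "La < ereal \<epsilon>" "ereal \<epsilon> < Lb"
    then show "prob {x \<in> space M. (SUP n\<in>{1..}. ereal (\<zeta> \<epsilon> * (X n x - real m * \<epsilon>) - \<phi> (\<zeta> \<epsilon>) * (real n - real m))) \<ge> 0}
      \<le> exp (\<phi> (\<zeta> \<epsilon>) - \<epsilon> * \<zeta> \<epsilon>) ^ m" by (intro i) (simp add: I_def)
  qed (rule ii iii; assumption)+
qed

end
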